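(* Fix a class label $\mathbf c$, let $p(\cdot\mid\mathbf c)$ be the class-conditional density on $\mathbb R^d$, let $p(\cdot)=\mathbb E_{\mathbf c}[p(\cdot\mid\mathbf c)]$ be the unconditional density, let $p_{\mathrm{ref}}(\cdot\mid\mathbf c)$ be a base-model density, and let $\beta>0$. Assume $p(\cdot\mid\mathbf c)$, $p(\cdot)$, $p_{\mathrm{ref}}(\cdot\mid\mathbf c)$ are strictly positive and that $\int p_{\mathrm{ref}}(\mathbf x\mid\mathbf c)\left(\frac{p(\mathbf x\mid\mathbf c)}{p(\mathbf x)}\right)^{1/\beta}d\mathbf x<\infty$. Let $\lambda>0$ be the constant with $$\lambda^{1/\beta}=\int p_{\mathrm{ref}}(\mathbf x\mid\mathbf c)\left(\frac{p(\mathbf x\mid\mathbf c)}{p(\mathbf x)}\right)^{1/\beta}d\mathbf x .$$ Then the global maximizer, over probability densities $p_\theta(\cdot\mid\mathbf c)$, of the Conditional Contrastive Alignment (CCA) objective $$\mathbb E_{\mathbf x\sim p(\cdot\mid\mathbf c)}\left[\log\mathrm{Sigmoid}\left(\beta\log\frac{p_\theta(\mathbf x\mid\mathbf c)}{p_{\mathrm{ref}}(\mathbf x\mid\mathbf c)}\right)\right]+\lambda\,\mathbb E_{\mathbf x\sim p(\cdot)}\left[\log\mathrm{Sigmoid}\left(-\beta\log\frac{p_\theta(\mathbf x\mid\mathbf c)}{p_{\mathrm{ref}}(\mathbf x\mid\mathbf c)}\right)\right]$$ is $$p_{\theta^*}(\mathbf x\mid\mathbf c)=\lambda^{-1/\beta}\,p_{\mathrm{ref}}(\mathbf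 x\mid\mathbf c)\left(\frac{p(\mathbf x\mid\mathbf c)}{p(\mathbf x)}\right)^{1/\beta},$$ and it coincides with the optimal solution, over probability densities $p_\theta(\cdot\mid\mathbf c)$, of the Conditional Contrastive DPO (CC-DPO) problem $$\min_{p_\theta(\cdot\mid\mathbf c)}\ -\mathbb E_{\mathbf x_w\sim p(\cdot\mid\mathbf c),\ \mathbf x_l\sim p(\cdot)}\log\mathrm{Sigmoid}\left(\beta\log\frac{p_\theta(\mathbf x_w\mid\mathbf c)}{p_{\mathrm{ref}}(\mathbf x_w\mid\mathbf c)}-\beta\log\frac{p_\theta(\mathbf x_l\mid\mathbf c)}{p_{\mathrm{ref}}(\mathbf x_l\mid\mathbf c)}\right).$$
   Context: $\mathrm{Sigmoid}(u)=1/(1+e^{-u})$. The samples $\mathbf x_w$ and $\mathbf x_l$ are independent. The model is nonparametric (the optimization variable is the strictly positive density $p_\theta(\cdot\mid\mathbf c)$ itself), and densities are identified up to null sets. *)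

theory Defs
  imports "HOL-Probability.Probability"
begin

definition sigmoid :: "real \<Rightarrow> real" where
  "sigmoid u = 1 / (1 + exp (- u))"

text \<open>
  Extended-real expectation, positive part minus negative part. The objectives below integrate
  functions of constant sign which need not be integrable, and for those the expectation has to
  be infinite; the Bochner integral would return 0.
\<close>
definition ext_expectation :: "'a measure \<Rightarrow> ('a \<Rightarrow> real) \<Rightarrow> ereal" where
  "ext_expectation M f =
     enn2ereal (\<integral>\<^sup>+ x. ennreal (f x) \<partial>M) - enn2ereal (\<integral>\<^sup>+ x. ennreal (- f x) \<partial>M)"

definition prob_density :: "(real ^ 'd \<Rightarrow> real) \<Rightarrow> bool" where
  "prob_density f \<longleftrightarrow>
     f \<in> borel_measurable lborel \<and> (\<forall>x. 0 \<le> f x) \<and> (\<integral>\<^sup>+ x. ennreal (f x) \<partial>lborel) = 1"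

text \<open>Densities are identified up to null sets, so strict positivity is meant almost everywhere.\<close>
definition pos_prob_density :: "(real ^ 'd \<Rightarrow> real) \<Rightarrow> bool" where
  "pos_prob_density f \<longleftrightarrow> prob_density f \<and> (AE x in lborel. 0 < f x)"

definition density_measure :: "(real ^ 'd \<Rightarrow> real) \<Rightarrow> (real ^ 'd) measure" where
  "density_measure f = density lborel (\<lambda>x. ennreal (f x))"

text \<open>
  \<open>C\<close> is the distribution of the class label. When all \<open>pc c\<close> are probability densities and
  \<open>pc\<close> is jointly measurable, the integrand is integrable over \<open>C\<close> for almost every \<open>x\<close>.
\<close>
definition unconditional_density ::
    "'c measure \<Rightarrow> ('c \<Rightarrow> real ^ 'd \<Rightarrow> real) \<Rightarrow> real ^ 'd \<Rightarrow> real" where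
  "unconditional_density C pc x = (\<integral> c. pc c x \<partial>C)"

definition cca_objective ::
    "real \<Rightarrow> real \<Rightarrow> (real ^ 'd \<Rightarrow> real) \<Rightarrow> (real ^ 'd \<Rightarrow> real) \<Rightarrow> (real ^ 'd \<Rightarrow> real) \<Rightarrow>
     (real ^ 'd \<Rightarrow> real) \<Rightarrow> ereal" where
  "cca_objective \<beta> lam p_cond p_unc p_ref p_theta =
     ext_expectation (density_measure p_cond)
       (\<lambda>x. ln (sigmoid (\<beta> * ln (p_theta x / p_ref x))))
     + ereal lam * ext_expectation (density_measure p_unc)
       (\<lambda>x. ln (sigmoid (- \<beta> * ln (p_theta x / p_ref x))))"

definition ccdpo_loss ::
    "real \<Rightarrow> (real ^ 'd \<Rightarrow> real) \<Rightarrow> (real ^ 'd \<Rightarrow> real) \<Rightarrow> (real ^ 'd \<Rightarrow> real) \<Rightarrow>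
     (real ^ 'd \<Rightarrow> real) \<Rightarrow> ereal" where
  "ccdpo_loss \<beta> p_cond p_unc p_ref p_theta =
     - ext_expectation (density_measure p_cond \<Otimes>\<^sub>M density_measure p_unc)
         (\<lambda>(xw, xl). ln (sigmoid
            (\<beta> * ln (p_theta xw / p_ref xw) - \<beta> * ln (p_theta xl / p_ref xl))))"

end

theory Submission imports Defs begin

text \<open>
  Both objectives are, up to sign and a factor, integrals of
  \<open>A ln (1 + e\<^sup>-\<^sup>u) + B ln (1 + e\<^sup>u)\<close>, which for positive weights \<open>A\<close>, \<open>B\<close>
  has the unique pointwise minimizer \<open>u = ln (A / B)\<close>, with minimum at most \<open>A + B\<close>. Let
  \<open>h = \<beta> ln (p\<^sub>\<theta> / p\<^sub>r\<^sub>e\<^sub>f)\<close>. For CCA, take \<open>A = p(x|c)\<close>, \<open>B = \<lambda> p(x)\<close>, \<open>u = h(x)\<close>.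
  For CC-DPO, average the loss with its image under swapping the two samples and take
  \<open>A = p(x|c) p(y)\<close>, \<open>B = p(y|c) p(x)\<close>, \<open>u = h(x) - h(y)\<close>; this determines \<open>h\<close> up to an
  additive constant, and normalization of the density fixes the constant.
\<close>

section \<open>Pointwise minimization of the weighted logistic loss\<close>

definition logistic_loss :: "real \<Rightarrow> real \<Rightarrow> real \<Rightarrow> real" where
  "logistic_loss A B u = A * ln (1 + exp (- u)) + B * ln (1 + exp u)"

lemma ln_sigmoid: "ln (sigmoid u) = - ln (1 + exp (- u))"
  unfolding sigmoid_def by (simp add: ln_div add_pos_pos)

lemma logistic_loss_nonneg: "0 \<le> A \<Longrightarrow> 0 \<le> B \<Longrightarrow> 0 \<le> logistic_loss A B u"
  unfolding logistic_loss_def by simp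

lemma logistic_loss_ln_ratio:
  assumes "0 < A" "0 < B"
  shows "logistic_loss A B (ln (A / B)) = A * ln ((A + B) / A) + B * ln ((A + B) / B)"
  using assms by (simp add: logistic_loss_def exp_minus field_simps)

text \<open>By ln t \<le> t - 1 the two summands are at most \<open>B\<close> and \<open>A\<close>.
  The bound makes the minimal loss integrable as soon as the weights are, which uniqueness for the
  integrated loss relies on.\<close>

lemma logistic_loss_ln_ratio_le:
  assumes "0 < A" "0 < B"
  shows "logistic_loss A B (ln (A / B)) \<le> A + B"
proof -
  have "ln ((A + B) / A) \<le> B / A" "ln ((A + B) / B) \<le> A / B"
    using assms ln_le_minus_one[of "(A + B) / A"] ln_le_minus_one[of "(A + B) / B"]
    by (simp_all add: field_simps)
  then have "A * ln ((A + B) / A) \<le> A * (B / A)" "B * ln ((A + B) / B) \<le> B * (A / B)"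
    using assms by (simp_all only: mult_left_mono less_imp_le)
  then show ?thesis
    using assms by (simp add: logistic_loss_ln_ratio)
qed

text \<open>This is Gibbs' inequality on two points: the distribution proportional to
  (\<open>A\<close>, \<open>B\<close>) is compared with (\<open>sigmoid u\<close>,
  \<open>sigmoid (- u)\<close>).\<close>

lemma logistic_loss_minimum:
  assumes "0 < A" "0 < B"
  shows "logistic_loss A B (ln (A / B)) \<le> logistic_loss A B u"
    and "logistic_loss A B u \<le> logistic_loss A B (ln (A / B)) \<Longrightarrow> u = ln (A / B)"
proof -
  \<comment> \<open>\<open>z\<close> and \<open>w\<close> are the likelihood ratios of the sigmoid
    pair to the normalized weights. The difference of the losses is the weighted sum of their
    logarithms, and ln t \<le> t - 1 bounds it by a sum that vanishes.\<close>
  define z where "z = (A + B) / (A * (1 + exp (- u)))"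
  define w where "w = (A + B) / (B * (1 + exp u))"
  have e: "0 < 1 + exp u" "0 < 1 + exp (- u)" by (simp_all add: add_pos_pos)
  have pos: "0 < z" "0 < w"
    using assms e by (simp_all add: z_def w_def)
  have ln_z: "ln z = ln ((A + B) / A) - ln (1 + exp (- u))"
    and ln_w: "ln w = ln ((A + B) / B) - ln (1 + exp u)"
    using assms e by (simp_all add: z_def w_def ln_div ln_mult)
  have sum: "A * (z - 1) + B * (w - 1) = 0"
  proof -
    have "A * z = (A + B) * (1 / (1 + exp (- u)))" "B * w = (A + B) * (1 / (1 + exp u))"
      using assms by (simp_all add: z_def w_def)
    moreover have "1 / (1 + exp (- u)) + 1 / (1 + exp u) = 1"
      using e by (simp add: exp_minus divide_simps algebra_simps)
    ultimately have "A * z + B * w = A + B"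
      by (metis distrib_left mult.right_neutral)
    then show ?thesis by (simp add: algebra_simps)
  qed
  have diff: "logistic_loss A B (ln (A / B)) - logistic_loss A B u = A * ln z + B * ln w"
    unfolding ln_z ln_w logistic_loss_ln_ratio[OF assms] by (simp add: logistic_loss_def algebra_simps)
  have z: "A * ln z \<le> A * (z - 1)" and w: "B * ln w \<le> B * (w - 1)"
    using assms pos by (simp_all add: ln_le_minus_one)
  show "logistic_loss A B (ln (A / B)) \<le> logistic_loss A B u"
    using diff sum z w by linarith
  assume "logistic_loss A B u \<le> logistic_loss A B (ln (A / B))"
  \<comment> \<open>The bounds \<open>z\<close> and \<open>w\<close> add up to 0 while the
    difference is now nonnegative, so both are attained; ln t = t - 1 only at t = 1.\<close>
  then have "A * ln z = A * (z - 1)"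
    using diff sum z w by linarith
  then have "z = 1" using assms pos ln_eq_minus_one by simp
  then have "exp u = A / B"
    using assms e by (simp add: z_def exp_minus field_simps)
  then show "u = ln (A / B)" by (metis ln_exp)
qed

text \<open>The pointwise minimum is integrated. Uniqueness survives because two integrands that are
  ordered almost everywhere and have the same finite integral agree almost everywhere.\<close>

lemma logistic_loss_integral_minimum:
  fixes A B u v :: "'a \<Rightarrow> real"
  assumes [measurable]: "A \<in> borel_measurable M" "B \<in> borel_measurable M"
      "u \<in> borel_measurable M" "v \<in> borel_measurable M"
    and pos: "AE x in M. 0 < A x" "AE x in M. 0 < B x"
    and v: "AE x in M. v x = ln (A x / B x)"
    and fin: "(\<integral>\<^sup>+ x. ennreal (A x) \<partial>M) < \<infinity>" "(\<integral>\<^sup>+ x. ennreal (B x) \<partial>M) < \<infinity>"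
  defines "L \<equiv> \<lambda>u. \<integral>\<^sup>+ x. ennreal (logistic_loss (A x) (B x) (u x)) \<partial>M"
  shows "L v \<le> L u" and "L u \<le> L v \<Longrightarrow> AE x in M. u x = v x"
proof -
  have le: "AE x in M. ennreal (logistic_loss (A x) (B x) (v x)) \<le> ennreal (logistic_loss (A x) (B x) (u x))"
    using pos v by eventually_elim (simp add: ennreal_leI logistic_loss_minimum(1))
  then show "L v \<le> L u"
    unfolding L_def by (rule nn_integral_mono_AE)
  \<comment> \<open>Finiteness of \<open>L v\<close> is essential: a strict pointwise inequality
    gives a strict inequality of integrals only if the smaller integral is finite.\<close>
  have "L v \<le> (\<integral>\<^sup>+ x. ennreal (A x) + ennreal (B x) \<partial>M)"
    unfolding L_def
    by (rule nn_integral_mono_AE, use pos v in eventually_elim)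
      (simp add: logistic_loss_ln_ratio_le ennreal_leI flip: ennreal_plus)
  also have "\<dots> < \<infinity>"
    using fin by (simp add: nn_integral_add)
  finally have v_fin: "L v \<noteq> \<infinity>" by simp
  assume Lu: "L u \<le> L v"
  have "AE x in M. ennreal (logistic_loss (A x) (B x) (u x)) \<le> ennreal (logistic_loss (A x) (B x) (v x))"
  proof (rule ccontr)
    assume "\<not> ?thesis"
    then have "L v < L u"
      using v_fin le unfolding L_def
      by (intro nn_integral_less) (simp_all add: logistic_loss_def)
    with Lu show False by simp
  qed
  then show "AE x in M. u x = v x"
    using pos v
    by eventually_elim (simp add: logistic_loss_minimum(2) logistic_loss_nonneg)
qed

section \<open>The two objectives as integrals of the logistic loss\<close>

lemma ext_expectation_ln_sigmoid:
  "ext_expectation M (\<lambda>x. ln (sigmoid (u x)))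
     = - enn2ereal (\<integral>\<^sup>+ x. ennreal (ln (1 + exp (- u x))) \<partial>M)"
proof -
  have "(\<integral>\<^sup>+ x. ennreal (- ln (1 + exp (- u x))) \<partial>M) = 0"
    by (simp add: ennreal_neg)
  then show ?thesis
    by (simp add: ext_expectation_def ln_sigmoid zero_ennreal.rep_eq)
qed

lemma prob_densityD:
  assumes "prob_density f"
  shows "f \<in> borel_measurable lborel" "0 \<le> f x" "(\<integral>\<^sup>+ x. ennreal (f x) \<partial>lborel) = 1"
  using assms by (auto simp: prob_density_def)

lemma prob_density_unconditional:
  fixes pc :: "'c \<Rightarrow> real ^ 'd \<Rightarrow> real"
  assumes "prob_space C"
    and meas: "(\<lambda>(c, x). pc c x) \<in> borel_measurable (C \<Otimes>\<^sub>M lborel)"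
    and dens: "\<And>c. c \<in> space C \<Longrightarrow> prob_density (pc c)"
  shows "prob_density (unconditional_density C pc)"
proof -
  interpret C: prob_space C by fact
  interpret P: pair_sigma_finite C "lborel :: (real ^ 'd) measure" ..
  note [measurable] = meas
  have int: "(\<integral>\<^sup>+ x. (\<integral>\<^sup>+ c. ennreal (pc c x) \<partial>C) \<partial>lborel) = 1"
  proof -
    have "(\<integral>\<^sup>+ x. (\<integral>\<^sup>+ c. ennreal (pc c x) \<partial>C) \<partial>lborel)
        = (\<integral>\<^sup>+ c. (\<integral>\<^sup>+ x. ennreal (pc c x) \<partial>lborel) \<partial>C)"
      by (rule P.Fubini') measurable
    also have "\<dots> = (\<integral>\<^sup>+ c. 1 \<partial>C)"
      by (intro nn_integral_cong) (simp add: prob_densityD dens)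
    finally show ?thesis by (simp add: C.emeasure_space_1)
  qed
  \<comment> \<open>Total mass one makes the inner integral finite for almost every x. At the
    remaining points the Bochner integral in \<open>unconditional_density\<close> takes its default
    value 0, which only affects a null set.\<close>
  have "AE x in lborel. (\<integral>\<^sup>+ c. ennreal (pc c x) \<partial>C) \<noteq> \<infinity>"
    by (rule nn_integral_PInf_AE) (use int in simp_all)
  then have "AE x in lborel. ennreal (unconditional_density C pc x) = (\<integral>\<^sup>+ c. ennreal (pc c x) \<partial>C)"
  proof eventually_elim
    case (elim x)
    have "(\<lambda>c. pc c x) \<in> borel_measurable C" by measurable
    moreover have "AE c in C. 0 \<le> pc c x"
      using dens by (auto intro!: AE_I2 prob_densityD)
    ultimately show ?case
      using elim unfolding unconditional_density_def
      by (subst nn_integral_eq_integral) (auto intro!: integrableI_nonneg simp: less_top)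
  qed
  then have "(\<integral>\<^sup>+ x. ennreal (unconditional_density C pc x) \<partial>lborel) = 1"
    using int nn_integral_cong_AE by metis
  moreover have "unconditional_density C pc \<in> borel_measurable lborel"
    unfolding unconditional_density_def by measurable
  moreover have "0 \<le> unconditional_density C pc x" for x
    unfolding unconditional_density_def
    using dens by (intro integral_nonneg_AE AE_I2) (simp add: prob_densityD)
  ultimately show ?thesis by (simp add: prob_density_def)
qed

lemma cca_objective_eq:
  assumes "prob_density a" "prob_density b" "0 \<le> lam"
    and [measurable]: "r \<in> borel_measurable lborel" "q \<in> borel_measurable lborel"
  shows "cca_objective \<beta> lam a b r q
    = - enn2ereal (\<integral>\<^sup>+ x. ennreal (logistic_loss (a x) (lam * b x) (\<beta> * ln (q x / r x))) \<partial>lborel)"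
proof -
  note [measurable] = prob_densityD(1)[OF assms(1)] prob_densityD(1)[OF assms(2)]
  define h where "h x = \<beta> * ln (q x / r x)" for x
  have [measurable]: "h \<in> borel_measurable lborel" unfolding h_def by measurable
  define I where "I = (\<integral>\<^sup>+ x. ennreal (a x) * ennreal (ln (1 + exp (- h x))) \<partial>lborel)"
  define J where "J = (\<integral>\<^sup>+ x. ennreal (b x) * ennreal (ln (1 + exp (h x))) \<partial>lborel)"
  have "ennreal (logistic_loss (a x) (lam * b x) (h x))
      = ennreal (a x) * ennreal (ln (1 + exp (- h x)))
        + ennreal lam * (ennreal (b x) * ennreal (ln (1 + exp (h x))))" for x
    using assms(3) prob_densityD(2)[OF assms(1)] prob_densityD(2)[OF assms(2)]
    by (simp add: logistic_loss_def ennreal_plus ennreal_mult mult.assoc)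
  then have L: "(\<integral>\<^sup>+ x. ennreal (logistic_loss (a x) (lam * b x) (h x)) \<partial>lborel) = I + ennreal lam * J"
    unfolding I_def J_def by (simp add: nn_integral_add nn_integral_cmult)
  have E: "cca_objective \<beta> lam a b r q = - enn2ereal I + ereal lam * - enn2ereal J"
    unfolding cca_objective_def density_measure_def I_def J_def
      mult_minus_left ext_expectation_ln_sigmoid
    by (simp add: nn_integral_density flip: h_def)
  have "enn2ereal (I + ennreal lam * J) = enn2ereal I + ereal lam * enn2ereal J"
    using assms(3) by (simp add: plus_ennreal.rep_eq times_ennreal.rep_eq)
  \<comment> \<open>Negation distributes over a sum of extended reals once opposite infinities are
    excluded; here both terms are nonnegative.\<close>
  moreover have "0 \<le> ereal lam * enn2ereal J" using assms(3) by simp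
  ultimately show ?thesis
    unfolding E L[unfolded h_def]
    by (cases "enn2ereal I"; cases "ereal lam * enn2ereal J") auto
qed

text \<open>Exchanging the two samples leaves the product Lebesgue measure invariant, so the loss
  equals the integral of its swapped integrand. Adding the two copies gives the factor 2 and a
  logistic loss in the single variable \<open>h x - h y\<close>.\<close>

lemma ccdpo_loss_eq:
  fixes a b r q :: "real ^ 'd \<Rightarrow> real" and \<beta> :: real
  assumes "prob_density a" "prob_density b"
    and [measurable]: "r \<in> borel_measurable lborel" "q \<in> borel_measurable lborel"
  defines "h \<equiv> \<lambda>x. \<beta> * ln (q x / r x)"
  shows "2 * ccdpo_loss \<beta> a b r q
    = enn2ereal (\<integral>\<^sup>+ z. ennreal (logistic_loss (a (fst z) * b (snd z)) (a (snd z) * b (fst z))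
        (h (fst z) - h (snd z))) \<partial>(lborel \<Otimes>\<^sub>M lborel))"
proof -
  note [measurable] = prob_densityD(1)[OF assms(1)] prob_densityD(1)[OF assms(2)]
  have [measurable]: "h \<in> borel_measurable lborel" unfolding h_def by measurable
  have nonneg: "0 \<le> a x" "0 \<le> b x" for x
    using assms(1,2) prob_densityD(2) by auto
  let ?M = "lborel \<Otimes>\<^sub>M lborel :: ((real ^ 'd) \<times> (real ^ 'd)) measure"
  define F where "F x y = ennreal (a x * b y * ln (1 + exp (h y - h x)))" for x y
  have [measurable]: "(\<lambda>z. F (fst z) (snd z)) \<in> borel_measurable ?M"
      "(\<lambda>z. F (snd z) (fst z)) \<in> borel_measurable ?M"
    unfolding F_def by measurable
  define I where "I = (\<integral>\<^sup>+ z. F (fst z) (snd z) \<partial>?M)"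
  \<comment> \<open>This supplies the sigma-finiteness of the second factor that the product formula
    for densities asks for.\<close>
  have "prob_space (density_measure b)"
    using assms(2) by (intro prob_spaceI)
      (simp add: density_measure_def emeasure_density prob_density_def)
  then interpret b: prob_space "density lborel (\<lambda>x. ennreal (b x))"
    by (simp add: density_measure_def)
  have pair: "density_measure a \<Otimes>\<^sub>M density_measure b
      = density ?M (\<lambda>(x, y). ennreal (a x) * ennreal (b y))"
    unfolding density_measure_def
    by (rule pair_measure_density) (measurable, unfold_locales)
  have "ccdpo_loss \<beta> a b r q = enn2ereal I"
  proof -
    have "ccdpo_loss \<beta> a b r q = enn2ereal (\<integral>\<^sup>+ z. ennreal (ln (1 + exp (h (snd z) - h (fst z))))
        \<partial>(density_measure a \<Otimes>\<^sub>M density_measure b))"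
      unfolding ccdpo_loss_def case_prod_beta ext_expectation_ln_sigmoid
      by (simp add: h_def)
    also have "\<dots> = enn2ereal I"
      unfolding pair I_def F_def
      by (subst nn_integral_density)
        (auto intro!: arg_cong[where f = enn2ereal] nn_integral_cong
          simp: ennreal_mult nonneg split: prod.splits)
    finally show ?thesis .
  qed
  moreover have "(\<integral>\<^sup>+ z. F (snd z) (fst z) \<partial>?M) = I"
  proof -
    have "I = (\<integral>\<^sup>+ z. F (fst z) (snd z) \<partial>distr ?M ?M (\<lambda>(x, y). (y, x)))"
      unfolding I_def
      by (rule arg_cong[where f = "\<lambda>M. \<integral>\<^sup>+ z. F (fst z) (snd z) \<partial>M", OF lborel_pair.distr_pair_swap])
    also have "\<dots> = (\<integral>\<^sup>+ z. F (snd z) (fst z) \<partial>?M)"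
      by (subst nn_integral_distr) (auto simp: case_prod_beta)
    finally show ?thesis by simp
  qed
  moreover have "ennreal (logistic_loss (a (fst z) * b (snd z)) (a (snd z) * b (fst z)) (h (fst z) - h (snd z)))
      = F (fst z) (snd z) + F (snd z) (fst z)" for z
    by (simp add: F_def logistic_loss_def nonneg flip: ennreal_plus)
  then have "(\<integral>\<^sup>+ z. ennreal (logistic_loss (a (fst z) * b (snd z)) (a (snd z) * b (fst z))
        (h (fst z) - h (snd z))) \<partial>?M) = I + (\<integral>\<^sup>+ z. F (snd z) (fst z) \<partial>?M)"
    by (simp add: I_def nn_integral_add)
  moreover have "2 * x = x + x" for x :: ereal
    by (cases x) auto
  ultimately show ?thesis
    by (simp only: plus_ennreal.rep_eq)
qed

text \<open>\<open>lam powr s\<close> is exactly the normalizing constant. Integrability lets the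
  Bochner integral that determines \<open>lam\<close> be read as the nonnegative integral in
  \<open>prob_density\<close>.\<close>

lemma pos_prob_density_tilted:
  fixes a b r :: "real ^ 'd \<Rightarrow> real"
  assumes "prob_density r" and [measurable]: "a \<in> borel_measurable lborel" "b \<in> borel_measurable lborel"
    and pos: "AE x in lborel. 0 < r x" "AE x in lborel. 0 < a x" "AE x in lborel. 0 < b x"
    and int: "integrable lborel (\<lambda>x. r x * (a x / b x) powr s)"
    and lam: "0 < lam" "lam powr s = (\<integral> x. r x * (a x / b x) powr s \<partial>lborel)"
  shows "pos_prob_density (\<lambda>x. lam powr (- s) * r x * (a x / b x) powr s)"
proof -
  note [measurable] = prob_densityD(1)[OF assms(1)]
  have "(\<integral>\<^sup>+ x. ennreal (lam powr (- s) * r x * (a x / b x) powr s) \<partial>lborel)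
      = ennreal (\<integral> x. lam powr (- s) * (r x * (a x / b x) powr s) \<partial>lborel)"
    using int prob_densityD(2)[OF assms(1)]
    by (subst nn_integral_eq_integral[symmetric]) (simp_all add: mult.assoc)
  also have "\<dots> = ennreal (lam powr (- s) * lam powr s)"
    by (simp add: lam(2))
  also have "\<dots> = 1" using lam(1) by (simp flip: powr_add)
  finally have "prob_density (\<lambda>x. lam powr (- s) * r x * (a x / b x) powr s)"
    using prob_densityD(2)[OF assms(1)] by (simp add: prob_density_def)
  moreover have "AE x in lborel. 0 < lam powr (- s) * r x * (a x / b x) powr s"
    using pos by eventually_elim (use lam in simp)
  ultimately show ?thesis by (simp add: pos_prob_density_def)
qed

text \<open>\<open>P\<close> may be non-measurable, so the exceptions are covered by a null set
  \<open>N\<close>; a bad pair then lies in one of the two null strips over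
  \<open>N\<close>.\<close>

lemma AE_pair_fst_snd:
  assumes "AE x in M. P x" "sigma_finite_measure M"
  shows "AE z in M \<Otimes>\<^sub>M M. P (fst z) \<and> P (snd z)"
proof -
  interpret sigma_finite_measure M by fact
  interpret pair_sigma_finite M M ..
  obtain N where N: "{x \<in> space M. \<not> P x} \<subseteq> N" "N \<in> null_sets M"
    using assms(1) by (auto simp: eventually_ae_filter)
  have "N \<times> space M \<in> null_sets (M \<Otimes>\<^sub>M M)" "space M \<times> N \<in> null_sets (M \<Otimes>\<^sub>M M)"
    using N(2) by (auto intro: times_in_null_sets1 times_in_null_sets2)
  then have "N \<times> space M \<union> space M \<times> N \<in> null_sets (M \<Otimes>\<^sub>M M)" by blast
  then show ?thesis
    by (rule AE_I') (use N(1) in \<open>auto simp: space_pair_measure\<close>)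
qed

theorem mainTheorem5:
  fixes C :: "'c measure"
    and c :: 'c
    and pc :: "'c \<Rightarrow> real ^ 'd \<Rightarrow> real"
    and p p_ref p_star :: "real ^ 'd \<Rightarrow> real"
    and \<beta> lam :: real
  assumes label_dist: "prob_space C"
    and label: "c \<in> space C"
    and pc_measurable: "(\<lambda>(c', x). pc c' x) \<in> borel_measurable (C \<Otimes>\<^sub>M lborel)"
    and pc_density: "\<And>c'. c' \<in> space C \<Longrightarrow> prob_density (pc c')"
    and p_eq: "p = unconditional_density C pc"
    and pc_pos: "AE x in lborel. 0 < pc c x"
    and p_pos: "AE x in lborel. 0 < p x"
    and p_ref: "pos_prob_density p_ref"
    and beta_pos: "0 < \<beta>"
    and finite_integral: "integrable lborel (\<lambda>x. p_ref x * (pc c x / p x) powr (1 / \<beta>))"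
    and lambda_pos: "0 < lam"
    and lambda_eq: "lam powr (1 / \<beta>) = (\<integral> x. p_ref x * (pc c x / p x) powr (1 / \<beta>) \<partial>lborel)"
    and p_star_eq:
      "p_star = (\<lambda>x. lam powr (- 1 / \<beta>) * p_ref x * (pc c x / p x) powr (1 / \<beta>))"
  shows "is_arg_max (cca_objective \<beta> lam (pc c) p p_ref) pos_prob_density p_star
    \<and> (\<forall>q. is_arg_max (cca_objective \<beta> lam (pc c) p p_ref) pos_prob_density q
            \<longrightarrow> (AE x in lborel. q x = p_star x))
    \<and> is_arg_min (ccdpo_loss \<beta> (pc c) p p_ref) pos_prob_density p_star
    \<and> (\<forall>q. is_arg_min (ccdpo_loss \<beta> (pc c) p p_ref) pos_prob_density q
            \<longrightarrow> (AE x in lborel. q x = p_star x))"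
proof -

  \<comment> \<open>The log-ratio of the candidate optimum\<close>
  define a where "a = pc c"
  define h where "h q x = \<beta> * ln (q x / p_ref x)" for q x
  have a: "prob_density a" unfolding a_def by (rule pc_density[OF label])
  have b: "prob_density p"
    unfolding p_eq by (rule prob_density_unconditional[OF label_dist pc_measurable pc_density])
  have ref: "prob_density p_ref" and ref_pos: "AE x in lborel. 0 < p_ref x"
    using p_ref by (simp_all add: pos_prob_density_def)
  note [measurable] = prob_densityD(1)[OF a] prob_densityD(1)[OF b] prob_densityD(1)[OF ref]
  have a_pos: "AE x in lborel. 0 < a x" using pc_pos by (simp add: a_def)
  have star: "pos_prob_density p_star"
    unfolding p_star_eq
    using pos_prob_density_tilted[of p_ref "pc c" p "1 / \<beta>" lam] assms(6-)
      ref prob_densityD(1)[OF a] prob_densityD(1)[OF b]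
    by (simp add: pos_prob_density_def a_def)
  \<comment> \<open>The exponents \<open>1 / \<beta>\<close> cancel against the factor
    \<open>\<beta>\<close> in \<open>h\<close>, which leaves the pointwise optimum for the weights
    \<open>a x\<close> and \<open>lam * p x\<close>.\<close>
  have star_h: "AE x in lborel. h p_star x = ln (a x / (lam * p x))"
    using a_pos p_pos ref_pos
  proof eventually_elim
    case (elim x)
    then have "p_star x / p_ref x = lam powr (- 1 / \<beta>) * (a x / p x) powr (1 / \<beta>)"
      by (simp add: p_star_eq a_def)
    then have "h p_star x = \<beta> * ((- 1 / \<beta>) * ln lam + (1 / \<beta>) * ln (a x / p x))"
      using elim lambda_pos by (simp add: h_def ln_mult ln_powr)
    moreover have "\<beta> * ((- 1 / \<beta>) * u + (1 / \<beta>) * v) = v - u" for u v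
      using beta_pos by (simp add: field_simps)
    ultimately show ?case
      using elim lambda_pos by (simp add: ln_div ln_mult)
  qed
  have h_meas: "h q \<in> borel_measurable lborel" if "pos_prob_density q" for q
  proof -
    have [measurable]: "q \<in> borel_measurable lborel"
      using that by (simp add: pos_prob_density_def prob_density_def)
    show ?thesis unfolding h_def by measurable
  qed

  \<comment> \<open>Minimization of the CCA integral\<close>
  define L where "L q = (\<integral>\<^sup>+ x. ennreal (logistic_loss (a x) (lam * p x) (h q x)) \<partial>lborel)" for q
  have cca: "cca_objective \<beta> lam (pc c) p p_ref q = - enn2ereal (L q)" if "pos_prob_density q" for q
    using cca_objective_eq[OF a b, of lam p_ref q \<beta>] lambda_pos that
    by (simp add: L_def h_def a_def pos_prob_density_def prob_density_def)
  have L_min: "L p_star \<le> L q" "L q \<le> L p_star \<Longrightarrow> AE x in lborel. h q x = h p_star x"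
    if q: "pos_prob_density q" for q
  proof -
    have fin: "(\<integral>\<^sup>+ x. ennreal (a x) \<partial>lborel) < \<infinity>"
        "(\<integral>\<^sup>+ x. ennreal (lam * p x) \<partial>lborel) < \<infinity>"
      using prob_densityD(2,3)[OF a] prob_densityD(2,3)[OF b] lambda_pos
      by (simp_all add: ennreal_mult nn_integral_cmult ennreal_mult_less_top)
    have pos: "AE x in lborel. 0 < lam * p x"
      using p_pos by eventually_elim (simp add: lambda_pos)
    have meas: "a \<in> borel_measurable lborel" "(\<lambda>x. lam * p x) \<in> borel_measurable lborel"
      by measurable
    note * = logistic_loss_integral_minimum[where A = a and B = "\<lambda>x. lam * p x" and u = "h q" and v = "h p_star"
        and M = lborel, OF meas h_meas[OF q] h_meas[OF star] a_pos pos star_h fin]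
    show "L p_star \<le> L q" unfolding L_def by (rule *(1))
    show "AE x in lborel. h q x = h p_star x" if "L q \<le> L p_star"
      using that unfolding L_def by (rule *(2))
  qed

  \<comment> \<open>Minimization of the CC-DPO integral over pairs\<close>
  let ?M = "lborel \<Otimes>\<^sub>M lborel :: ((real ^ 'd) \<times> (real ^ 'd)) measure"
  define A where "A z = a (fst z) * p (snd z)" for z
  define B where "B z = a (snd z) * p (fst z)" for z
  define g where "g q z = h q (fst z) - h q (snd z)" for q z
  define K where "K q = (\<integral>\<^sup>+ z. ennreal (logistic_loss (A z) (B z) (g q z)) \<partial>?M)" for q
  have dpo: "2 * ccdpo_loss \<beta> (pc c) p p_ref q = enn2ereal (K q)" if "pos_prob_density q" for q
    using ccdpo_loss_eq[OF a b, of p_ref q \<beta>] that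
    by (simp add: K_def A_def B_def g_def h_def a_def pos_prob_density_def prob_density_def)
  have pair_pos: "AE z in ?M. P (fst z) \<and> P (snd z)"
    if "AE x in lborel. P x" for P :: "real ^ 'd \<Rightarrow> bool"
    by (rule AE_pair_fst_snd[OF that lborel.sigma_finite_measure_axioms])
  have K_min: "K p_star \<le> K q" "K q \<le> K p_star \<Longrightarrow> AE z in ?M. g q z = g p_star z"
    if q: "pos_prob_density q" for q
  proof -
    note [measurable] = h_meas[OF q] h_meas[OF star]
    have meas: "A \<in> borel_measurable ?M" "B \<in> borel_measurable ?M"
        "g q \<in> borel_measurable ?M" "g p_star \<in> borel_measurable ?M"
      unfolding A_def B_def g_def by measurable
    have pos: "AE z in ?M. 0 < A z" "AE z in ?M. 0 < B z"
      using pair_pos[OF a_pos] pair_pos[OF p_pos]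
      by (eventually_elim, simp add: A_def B_def)+
    \<comment> \<open>The constant \<open>ln lam\<close> cancels in the difference of the two
      log-ratios, so the same candidate is optimal for the pair weights.\<close>
    have star_g: "AE z in ?M. g p_star z = ln (A z / B z)"
      using pair_pos[OF a_pos] pair_pos[OF p_pos] pair_pos[OF star_h]
      by eventually_elim
        (use lambda_pos in \<open>simp add: A_def B_def g_def ln_div ln_mult\<close>)
    have fin: "(\<integral>\<^sup>+ z. ennreal (A z) \<partial>?M) < \<infinity>" "(\<integral>\<^sup>+ z. ennreal (B z) \<partial>?M) < \<infinity>"
      unfolding A_def B_def
      using prob_densityD(2,3)[OF a] prob_densityD(2,3)[OF b]
      by (simp_all add: ennreal_mult nn_integral_cmult nn_integral_multc
          flip: lborel.nn_integral_fst)
    note * = logistic_loss_integral_minimum[where A = A and B = B and u = "g q" and v = "g p_star"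
        and M = ?M, OF meas pos star_g fin]
    show "K p_star \<le> K q" unfolding K_def by (rule *(1))
    show "AE z in ?M. g q z = g p_star z" if "K q \<le> K p_star"
      using that unfolding K_def by (rule *(2))
  qed

  \<comment> \<open>Recovering the density from its log-ratio\<close>
  have shift: "AE x in lborel. q x = p_star x"
    if q: "pos_prob_density q" and k: "AE x in lborel. h q x = h p_star x + k" for q k
  proof -
    have "AE x in lborel. 0 < q x" "AE x in lborel. 0 < p_star x"
      using q star by (simp_all add: pos_prob_density_def)
    then have scaled: "AE x in lborel. q x = exp (k / \<beta>) * p_star x"
      using k ref_pos
    proof eventually_elim
      case (elim x)
      then have "ln (q x) = ln (p_star x) + k / \<beta>"
        using beta_pos by (simp add: h_def ln_div field_simps)
      then show ?case
        using elim by (metis exp_add exp_ln mult.commute)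
    qed
    have dens: "prob_density q" "prob_density p_star"
      using q star by (simp_all add: pos_prob_density_def)
    \<comment> \<open>A constant shift of \<open>h\<close> rescales the density; since both
      densities have mass one, the scale factor is 1.\<close>
    have "(\<integral>\<^sup>+ x. ennreal (q x) \<partial>lborel) = (\<integral>\<^sup>+ x. ennreal (exp (k / \<beta>) * p_star x) \<partial>lborel)"
      using scaled by (intro nn_integral_cong_AE) (auto elim: eventually_mono)
    also have "\<dots> = ennreal (exp (k / \<beta>)) * (\<integral>\<^sup>+ x. ennreal (p_star x) \<partial>lborel)"
      using prob_densityD(1,2)[OF dens(2)] by (simp add: ennreal_mult nn_integral_cmult)
    finally have "ennreal (exp (k / \<beta>)) = 1"
      using prob_densityD(3)[OF dens(1)] prob_densityD(3)[OF dens(2)] by simp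
    then have "exp (k / \<beta>) = 1" by (simp only: ennreal_eq_1)
    with scaled show ?thesis by (simp only: mult_1)
  qed

  have K_shift: "\<exists>k. AE x in lborel. h q x = h p_star x + k"
    if g: "AE z in ?M. g q z = g p_star z" for q
  proof -
    \<comment> \<open>Lebesgue measure is nonzero, so a property holding almost everywhere has a
      witness. Fixing such a first sample \<open>x\<close> turns equality of the differences into
      equality up to the constant \<open>h q x - h p_star x\<close>.\<close>
    have "ae_filter (lborel :: (real ^ 'd) measure) \<noteq> bot"
      by (simp add: ae_filter_eq_bot_iff)
    moreover have "AE x in lborel. AE y in lborel. g q (x, y) = g p_star (x, y)"
      by (rule lborel_pair.AE_pair[OF g])
    ultimately obtain x where "AE y in lborel. g q (x, y) = g p_star (x, y)"
      using eventually_happens' by blast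
    then have "AE y in lborel. h q y = h p_star y + (h q x - h p_star x)"
      by eventually_elim (simp add: g_def)
    then show ?thesis by blast
  qed

  \<comment> \<open>Transfer from the integrals to the objectives\<close>
  have loss_le: "ccdpo_loss \<beta> (pc c) p p_ref q \<le> ccdpo_loss \<beta> (pc c) p p_ref q' \<longleftrightarrow> K q \<le> K q'"
    if "pos_prob_density q" "pos_prob_density q'" for q q'
  proof -
    \<comment> \<open>\<open>dpo\<close> describes only the doubled loss; doubling preserves and
      reflects the order of the extended reals, infinite values included.\<close>
    have "x \<le> y \<longleftrightarrow> 2 * x \<le> 2 * y" for x y :: ereal
      by (cases x; cases y) auto
    then show ?thesis
      by (metis dpo that less_eq_ennreal.rep_eq)
  qed
  have obj_le: "cca_objective \<beta> lam (pc c) p p_ref q \<le> cca_objective \<beta> lam (pc c) p p_ref q' \<longleftrightarrow> L q' \<le> L q"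
    if "pos_prob_density q" "pos_prob_density q'" for q q'
    using that by (simp add: cca less_eq_ennreal.rep_eq)

  have max: "is_arg_max (cca_objective \<beta> lam (pc c) p p_ref) pos_prob_density p_star"
    using star L_min(1) obj_le by (simp add: is_arg_max_linorder)
  have max_unique: "AE x in lborel. q x = p_star x"
    if "is_arg_max (cca_objective \<beta> lam (pc c) p p_ref) pos_prob_density q" for q
  proof -
    have q: "pos_prob_density q" and "cca_objective \<beta> lam (pc c) p p_ref p_star \<le> cca_objective \<beta> lam (pc c) p p_ref q"
      using that star unfolding is_arg_max_linorder by blast+
    then have "L q \<le> L p_star"
      using obj_le[OF star q] by blast
    \<comment> \<open>For CCA the log-ratio itself is determined, so the shift is 0.\<close>
    then show ?thesis using shift[OF q, of 0] L_min(2)[OF q] by simp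
  qed
  have min: "is_arg_min (ccdpo_loss \<beta> (pc c) p p_ref) pos_prob_density p_star"
    using star K_min(1) loss_le by (simp add: is_arg_min_linorder)
  have min_unique: "AE x in lborel. q x = p_star x"
    if "is_arg_min (ccdpo_loss \<beta> (pc c) p p_ref) pos_prob_density q" for q
  proof -
    have q: "pos_prob_density q" and "ccdpo_loss \<beta> (pc c) p p_ref q \<le> ccdpo_loss \<beta> (pc c) p p_ref p_star"
      using that star unfolding is_arg_min_linorder by blast+
    then have "K q \<le> K p_star"
      using loss_le[OF q star] by blast
    then obtain k where "AE x in lborel. h q x = h p_star x + k"
      using K_shift[OF K_min(2)[OF q]] by blast
    then show ?thesis by (rule shift[OF q])
  qed
  show ?thesis
    by (intro conjI allI impI max min max_unique min_unique)
qed

end
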